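(* Suppose that $k=\frac pq\in(0,1)$ with $p,q$ coprime positive integers and $q\ge 3$ odd. Let $E=2\cos\pi k$ and $$B_q=\frac{1+\cos\frac{\pi}{q}}{q\sin\frac{\pi}{q}}.$$ Then the following hold. (i) If $V$ is a real-valued potential with $\limsup_{n\to\infty}|nV(n)|<\frac{\sin\pi k}{B_q}$, then $E$ is not an eigenvalue of $\Delta+V$ (for any boundary condition). (ii) For every $\varepsilon>0$ and every prescribed boundary condition $u(1)\cos\varphi-u(0)\sin\varphi=0$, there exists a real-valued potential $V$ satisfying $\limsup_{n\to\infty}|nV(n)|<\frac{\sin\pi k}{B_q}+\varepsilon$ such that $E$ is an eigenvalue of $\Delta+V$ with this boundary condition. Consequently, the critical value at the energy $E=2\cos\pi k$ is $\mathcal C(k)=\frac{\sin\pi k}{B_q}$.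
   Context: $\mathbb N=\{1,2,3,\dots\}$. For a real-valued potential $V=V(n)$ with $V(n)=O(1)/(1+n)$, the discrete Schr\"odinger operator $H=\Delta+V$ on $\ell^2(\mathbb N)$ is $(Hu)(n)=u(n+1)+u(n-1)+V(n)u(n)$, $n\in\mathbb N$, with a self-adjoint boundary condition at the origin $u(1)\cos\varphi-u(0)\sin\varphi=0$ for some real $\varphi$. A number $E$ is an eigenvalue of $\Delta+V$ (with the given boundary condition) if there is a not identically zero $u:\{0,1,2,\dots\}\to\mathbb R$ satisfying $u(n+1)+u(n-1)+V(n)u(n)=Eu(n)$ for all $n\ge1$, the boundary condition, and $\sum_n|u(n)|^2<\infty$. For a potential $V$ put $a(V)=\limsup_{n\to\infty}|nV(n)|$. For $E=2\cos\pi k\in(-2,2)$, $k\in(0,1)$, the critical value $\mathcal C(E)=\mathcal C(k)$ is the number characterized by: (1) if $a(V)<\mathcal C(E)$ then $E$ is not an eigenvalue of $\Delta+V$; (2) for every $\varepsilon>0$ and every prescribed boundary condition there is a potential $V$ with $a(V)<\mathcal C(E)+\varepsilon$ such that $E$ is an eigenvalue of $\Delta+V$. *)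

theory Defs
  imports Complex_Main "HOL-Library.Extended_Real" "HOL-Library.Liminf_Limsup"
    "HOL-Library.Landau_Symbols"
begin

text \<open>
  A potential is a function on the positive integers; it is represented by
  \<open>V :: nat \<Rightarrow> real\<close>, whose value at \<open>0\<close> is never relevant below.
\<close>

definition potential :: "(nat \<Rightarrow> real) \<Rightarrow> bool" where
  "potential V \<longleftrightarrow> V \<in> O(\<lambda>n. 1 / (1 + real n))"

text \<open>Only meaningful for \<open>n \<ge> 1\<close>, since subtraction on \<open>nat\<close> truncates.\<close>

definition schroedinger :: "(nat \<Rightarrow> real) \<Rightarrow> (nat \<Rightarrow> real) \<Rightarrow> nat \<Rightarrow> real" where
  "schroedinger V u n = u (n + 1) + u (n - 1) + V n * u n"

definition boundary_condition :: "real \<Rightarrow> (nat \<Rightarrow> real) \<Rightarrow> bool" where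
  "boundary_condition \<phi> u \<longleftrightarrow> u 1 * cos \<phi> - u 0 * sin \<phi> = 0"

definition is_eigenvalue :: "(nat \<Rightarrow> real) \<Rightarrow> real \<Rightarrow> real \<Rightarrow> bool" where
  "is_eigenvalue V \<phi> E \<longleftrightarrow>
     (\<exists>u :: nat \<Rightarrow> real.
        (\<exists>n. u n \<noteq> 0) \<and>
        (\<forall>n\<ge>1. schroedinger V u n = E * u n) \<and>
        boundary_condition \<phi> u \<and>
        summable (\<lambda>n. \<bar>u n\<bar>\<^sup>2))"

definition pot_size :: "(nat \<Rightarrow> real) \<Rightarrow> ereal" where
  "pot_size V = limsup (\<lambda>n. ereal \<bar>real n * V n\<bar>)"

definition is_critical_value :: "real \<Rightarrow> real \<Rightarrow> bool" where
  "is_critical_value E C \<longleftrightarrow>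
     (\<forall>V \<phi>. potential V \<and> pot_size V < ereal C \<longrightarrow> \<not> is_eigenvalue V \<phi> E) \<and>
     (\<forall>\<epsilon>>0. \<forall>\<phi>. \<exists>V. potential V \<and> pot_size V < ereal (C + \<epsilon>) \<and> is_eigenvalue V \<phi> E)"

text \<open>
  At most one \<open>C\<close> satisfies \<open>is_critical_value E C\<close>: if \<open>C < C'\<close> both did, the second
  clause for \<open>C\<close> with \<open>\<epsilon> = C' - C\<close> would contradict the first clause for \<open>C'\<close>.
\<close>

definition critical_value :: "real \<Rightarrow> real" where
  "critical_value E = (THE C. is_critical_value E C)"

definition B :: "nat \<Rightarrow> real" where
  "B q = (1 + cos (pi / real q)) / (real q * sin (pi / real q))"

end

theory Submission
  imports Defs "HOL-Real_Asymp.Real_Asymp" "HOL-Analysis.Summation_Tests"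
    "HOL-Number_Theory.Cong"
begin

text \<open>
  Put \<open>\<theta> = pi * k\<close>. Free solutions at energy \<open>E\<close> are \<open>q\<close>-periodic up to sign, so the right quantity to
  follow is the peak \<open>M\<close> of \<open>\<bar>u\<bar>\<close> on a block of \<open>q\<close> consecutive sites. Variation of constants over one
  period, started at a peak \<open>m\<close>, shows that \<open>\<bar>V n\<bar> \<le> a / n\<close> can lower it by at most the factor
  \<open>1 - a * q * B q / (2 * m * sin \<theta>)\<close> to first order; the sum involved does not depend on where within its
  range the phase of the peak lies. If \<open>a < sin \<theta> / B q\<close>, the \<open>l\<close>-th block thus loses at most the
  factor \<open>1 - 1 / (2 * l)\<close>, so \<open>M\<^sup>2\<close> decays no faster than \<open>1 / l\<close>, which is not summable.

  The bound is attained at the symmetric phase. On the \<open>l\<close>-th block take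
  \<open>u = P l * (cos (j * \<theta>) + c l * corrector j)\<close>, where \<open>corrector\<close> is the first-order response to the
  potential with the sign of \<open>cos (j * \<theta>) * sin (j * \<theta>)\<close>. By antisymmetry under \<open>j \<mapsto> q - j\<close> the blocks
  fit together exactly with \<open>V = 0\<close> at their ends, once \<open>P (l + 1) / P l = 1 + c l * gain\<close>. Reading
  \<open>V\<close> off \<open>u\<close>, which never vanishes, leaves the first two values of \<open>u\<close> free for the boundary condition.
\<close>

section \<open>Variation of constants\<close>

text \<open>The kernel \<open>sin ((real j - real i) * \<theta>)\<close> is
  \<open>sin \<theta>\<close> times the free solution that is 0 at \<open>i\<close> and 1 at
  \<open>i + 1\<close>, the response to a unit impulse at \<open>i\<close>. Keeping
  \<open>sin \<theta>\<close> on the left avoids division.\<close>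

lemma variation_of_constants:
  fixes x g :: "nat \<Rightarrow> real" and \<theta> :: real
  assumes rec: "\<And>i. 1 \<le> i \<Longrightarrow> i < N \<Longrightarrow> x (i + 1) + x (i - 1) = 2 * cos \<theta> * x i + g i"
  shows "j \<le> N \<Longrightarrow> x j * sin \<theta> = x 0 * sin \<theta> * cos (real j * \<theta>)
      + (x 1 - x 0 * cos \<theta>) * sin (real j * \<theta>)
      + (\<Sum>i=1..<j. g i * sin ((real j - real i) * \<theta>))"
proof (induction j rule: induct_nat_012)
  case 0
  then show ?case by simp
next
  case 1
  then show ?case by (simp add: algebra_simps)
next
  case (ge2 j)
  define T where "T = real j * \<theta>"
  have c2: "2 * cos \<theta> * cos (real (j + 1) * \<theta>) - cos (real j * \<theta>) = cos (real (j + 2) * \<theta>)"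
    "2 * cos \<theta> * sin (real (j + 1) * \<theta>) - sin (real j * \<theta>) = sin (real (j + 2) * \<theta>)"
    using cos_add[of \<theta> "\<theta> + T"] sin_add[of \<theta> "\<theta> + T"] cos_diff[of "\<theta> + T" \<theta>] sin_diff[of "\<theta> + T" \<theta>]
    by (simp_all add: T_def algebra_simps)
  have trig: "2 * cos \<theta> * sin ((real (j + 1) - real i) * \<theta>) - sin ((real j - real i) * \<theta>)
      = sin ((real (j + 2) - real i) * \<theta>)" for i
    using sin_add[of "(real (j + 1) - real i) * \<theta>" \<theta>] sin_diff[of "(real (j + 1) - real i) * \<theta>" \<theta>]
    by (simp add: algebra_simps)
  define F where "F m = (\<Sum>i=1..<m. g i * sin ((real m - real i) * \<theta>))" for m
  have F1: "F (j + 1) = (\<Sum>i=1..<j + 1. g i * sin ((real (j + 1) - real i) * \<theta>))"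
    by (simp add: F_def)
  \<comment> \<open>For \<open>j > 0\<close> the added term \<open>i = j\<close> vanishes with
    \<open>sin 0\<close>; this gives all three sums the same range.\<close>
  have F0: "F j = (\<Sum>i=1..<j + 1. g i * sin ((real j - real i) * \<theta>))"
    by (cases "j = 0") (simp_all add: F_def)
  have F2: "F (j + 2) = (\<Sum>i=1..<j + 1. g i * sin ((real (j + 2) - real i) * \<theta>)) + g (j + 1) * sin \<theta>"
    by (simp add: F_def)
  have "F (j + 2) = 2 * cos \<theta> * F (j + 1) - F j + g (j + 1) * sin \<theta>"
    unfolding F0 F1 F2 trig[symmetric]
    by (simp add: right_diff_distrib sum_subtractf sum_distrib_left mult_ac del: sum.op_ivl_Suc of_nat_add)
  moreover have "x (j + 2) = 2 * cos \<theta> * x (j + 1) - x j + g (j + 1)"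
    using rec[of "j + 1"] ge2.prems by simp
  moreover have "x j * sin \<theta> = x 0 * sin \<theta> * cos (real j * \<theta>)
      + (x 1 - x 0 * cos \<theta>) * sin (real j * \<theta>) + F j"
    using ge2.IH(1) ge2.prems by (simp add: F_def)
  moreover have "x (j + 1) * sin \<theta> = x 0 * sin \<theta> * cos (real (j + 1) * \<theta>)
      + (x 1 - x 0 * cos \<theta>) * sin (real (j + 1) * \<theta>) + F (j + 1)"
    using ge2.IH(2) ge2.prems by (simp add: F_def)
  ultimately show ?case
    unfolding Suc_eq_plus1 add.assoc one_add_one by (simp only: c2[symmetric] F_def[symmetric]) algebra
qed

section \<open>Sums over the multiples of pi / q\<close>

text \<open>Telescoping with step two, since \<open>2 * sin x * sin (m * x) = cos ((m - 1) * x) -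
  cos ((m + 1) * x)\<close>; two terms survive at each end.\<close>

lemma sum_sin_multiples:
  fixes x :: real
  shows "2 * sin x * (\<Sum>m=1..<Suc n. sin (real m * x)) = 1 + cos x - cos (real n * x) - cos (real (Suc n) * x)"
proof (induction n)
  case 0
  then show ?case by simp
next
  case (Suc n)
  have "2 * sin x * sin (real (Suc n) * x) = cos (real n * x) - cos (real (Suc (Suc n)) * x)"
    using cos_add[of "real (Suc n) * x" x] cos_diff[of "real (Suc n) * x" x]
    by (simp add: algebra_simps)
  with Suc show ?case by (simp add: distrib_left del: of_nat_Suc)
qed

text \<open>The origin of \<open>B q\<close>: for \<open>x = pi / q\<close> the last two cosines of
  the telescoped sum are \<open>- cos x\<close> and \<open>-1\<close>, which leaves
  \<open>2 * (1 + cos x)\<close>.\<close>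

lemma sum_sin_pi_div:
  assumes "2 \<le> q"
  shows "(\<Sum>m=1..<q. sin (pi * real m / real q)) = real q * B q"
proof -
  obtain n where n: "q = Suc n" using assms by (cases q) auto
  define x where "x = pi / real q"
  have x: "0 < x" "x < pi" using assms by (auto simp: x_def field_simps)
  then have s: "sin x > 0" by (rule sin_gt_zero)
  have "real n * x = pi - x" "real (Suc n) * x = pi"
    using assms by (simp_all add: n x_def field_simps)
  then have "2 * sin x * (\<Sum>m=1..<q. sin (real m * x)) = 2 * (1 + cos x)"
    using sum_sin_multiples[of x n] by (simp only: n) simp
  then have "(\<Sum>m=1..<q. sin (real m * x)) = (1 + cos x) / sin x"
    using s by (simp add: field_simps)
  then show ?thesis using assms
    by (simp add: B_def x_def mult.commute)
qed

lemma periodic_add_multiple: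
  fixes G :: "real \<Rightarrow> 'a"
  assumes "\<And>t. G (t + d) = G t"
  shows "G (t + real n * d) = G t"
  by (induction n) (simp_all add: assms distrib_right add.assoc[symmetric], metis add.assoc add.commute assms)

lemma periodic_multiple_mod:
  fixes G :: "real \<Rightarrow> 'a"
  assumes "\<And>t. G (t + pi) = G t" and "0 < q"
  shows "G (pi * real m / real q) = G (pi * real (m mod q) / real q)"
proof -
  have "real m = real (m mod q) + real q * real (m div q)"
    by (metis mod_mult_div_eq of_nat_add of_nat_mult)
  then have "pi * real m / real q = pi * real (m mod q) / real q + real (m div q) * pi"
    using assms(2) by (simp add: field_simps)
  then show ?thesis using periodic_add_multiple[of G pi, OF assms(1)] by simp
qed

text \<open>A unit modulo \<open>q\<close> acts injectively and keeps nonzero residues nonzero;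
  finiteness gives surjectivity.\<close>

lemma mult_mod_bij_betw:
  fixes r q :: nat
  assumes "coprime r q"
  shows "bij_betw (\<lambda>i. r * i mod q) {1..<q} {1..<q}"
proof -
  have inj: "inj_on (\<lambda>i. r * i mod q) {1..<q}"
  proof (rule inj_onI)
    fix i j assume ij: "i \<in> {1..<q}" "j \<in> {1..<q}" "r * i mod q = r * j mod q"
    have "[r * i = r * j] (mod q)" using ij by (simp add: cong_def)
    then have "[i = j] (mod q)" using assms by (simp add: cong_mult_lcancel_nat)
    then show "i = j" using ij by (simp add: cong_def)
  qed
  moreover have "(\<lambda>i. r * i mod q) ` {1..<q} \<subseteq> {1..<q}"
  proof clarify
    fix i assume i: "i \<in> {1..<q}"
    have "\<not> q dvd r * i"
      using assms i by (metis atLeastLessThan_iff coprime_commute coprime_dvd_mult_right_iff nat_dvd_not_less not_one_le_zero zero_less_iff_neq_zero)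
    then show "r * i mod q \<in> {1..<q}" using i by (auto simp: dvd_eq_mod_eq_0 Suc_le_eq)
  qed
  ultimately show ?thesis
    by (metis bij_betw_def endo_inj_surj finite_atLeastLessThan)
qed

text \<open>Used with \<open>r = p\<close> to pass from the multiples of \<theta> to the equally
  spaced grid, and with \<open>r = 2\<close> to undo a doubled angle.\<close>

lemma sum_periodic_reindex:
  fixes G :: "real \<Rightarrow> real"
  assumes "\<And>t. G (t + pi) = G t" and "0 < q" and "coprime r q"
  shows "(\<Sum>i=1..<q. G (pi * real (r * i) / real q)) = (\<Sum>i=1..<q. G (pi * real i / real q))"
proof -
  have "(\<Sum>i=1..<q. G (pi * real (r * i) / real q)) = (\<Sum>i=1..<q. G (pi * real (r * i mod q) / real q))"
    by (rule sum.cong[OF refl], rule periodic_multiple_mod) (use assms in auto)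
  also have "\<dots> = (\<Sum>i=1..<q. G (pi * real i / real q))"
    by (rule sum.reindex_bij_betw[OF mult_mod_bij_betw[OF assms(3)], where g = "\<lambda>i. G (pi * real i / real q)"])
  finally show ?thesis .
qed

section \<open>The frequency and its symmetries\<close>

locale rational_energy =
  fixes p q :: nat and \<theta> :: real
  assumes p_pos: "0 < p" and p_less: "p < q" and coprime_pq: "coprime p q"
    and q_ge: "3 \<le> q" and odd_q: "odd q"
    and theta: "\<theta> = pi * real p / real q"
begin

lemma theta_multiple: "real i * \<theta> = pi * real (p * i) / real q"
  by (simp add: theta)

lemma sin_theta_pos: "sin \<theta> > 0"
proof (rule sin_gt_zero)
  show "0 < \<theta>" "\<theta> < pi" using p_pos p_less by (auto simp: theta field_simps)
qed

lemma B_pos: "B q > 0"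
proof -
  have "0 < pi / real q" "pi / real q < pi / 2"
    using q_ge by (auto intro!: divide_strict_left_mono simp: less_divide_eq divide_less_eq)
  moreover have "pi / 2 < pi" by simp
  ultimately have "0 < sin (pi / real q)" by (intro sin_gt_zero) linarith+
  moreover have "0 < cos (pi / real q)" using \<open>0 < pi / real q\<close> \<open>pi / real q < pi / 2\<close>
    by (rule cos_gt_zero)
  ultimately show ?thesis using q_ge by (simp add: B_def)
qed

lemma sin_q_theta: "sin (real q * \<theta>) = 0"
  using q_ge by (simp add: theta mult.commute[of pi] sin_npi)

lemma cos_q_theta: "cos (real q * \<theta>) = (-1) ^ p"
  using q_ge by (simp add: theta mult.commute[of pi] cos_npi)

text \<open>Since \<open>q * \<theta> = p * pi\<close>, reflecting \<open>i\<close> to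
  \<open>q - i\<close> multiplies sine and cosine by opposite signs. This symmetry balances each
  block of the construction.\<close>

lemma sin_q_theta_minus: "sin ((real q - real i) * \<theta>) = - ((-1) ^ p * sin (real i * \<theta>))"
  by (simp add: left_diff_distrib sin_diff sin_q_theta cos_q_theta)

lemma cos_q_theta_minus: "cos ((real q - real i) * \<theta>) = (-1) ^ p * cos (real i * \<theta>)"
  by (simp add: left_diff_distrib cos_diff sin_q_theta cos_q_theta)

lemma sum_theta_reindex:
  fixes G :: "real \<Rightarrow> real"
  assumes "\<And>t. G (t + pi) = G t"
  shows "(\<Sum>i=1..<q. G (real i * \<theta>)) = (\<Sum>i=1..<q. G (pi * real i / real q))"
  unfolding theta_multiple using assms coprime_pq q_ge by (intro sum_periodic_reindex) auto

text \<open>Each term is half the absolute sine of the doubled angle. As \<open>q\<close> is odd,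
  doubling permutes the nonzero residues, which leads back to \<open>sum_sin_pi_div\<close>.\<close>

lemma sum_abs_sin_cos_pi_div:
  "(\<Sum>i=1..<q. \<bar>cos (pi * real i / real q)\<bar> * \<bar>sin (pi * real i / real q)\<bar>) = real q * B q / 2"
proof -
  have "(\<Sum>i=1..<q. \<bar>cos (pi * real i / real q)\<bar> * \<bar>sin (pi * real i / real q)\<bar>)
      = (\<Sum>i=1..<q. \<bar>sin (pi * real (2 * i) / real q)\<bar>) / 2"
    unfolding sum_divide_distrib
  proof (rule sum.cong[OF refl])
    fix i
    have "sin (pi * real (2 * i) / real q) = 2 * sin (pi * real i / real q) * cos (pi * real i / real q)"
      using sin_double[of "pi * real i / real q"] by (simp add: mult_ac)
    then show "\<bar>cos (pi * real i / real q)\<bar> * \<bar>sin (pi * real i / real q)\<bar> = \<bar>sin (pi * real (2 * i) / real q)\<bar> / 2"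
      by (simp add: abs_mult)
  qed
  also have "(\<Sum>i=1..<q. \<bar>sin (pi * real (2 * i) / real q)\<bar>) = (\<Sum>i=1..<q. \<bar>sin (pi * real i / real q)\<bar>)"
    using odd_q q_ge by (intro sum_periodic_reindex) auto
  also have "\<dots> = (\<Sum>i=1..<q. sin (pi * real i / real q))"
  proof (rule sum.cong[OF refl])
    fix i assume "i \<in> {1..<q}"
    then have "0 < pi * real i / real q" "pi * real i / real q < pi" by (auto simp: field_simps)
    then show "\<bar>sin (pi * real i / real q)\<bar> = sin (pi * real i / real q)"
      using sin_gt_zero by fastforce
  qed
  also have "\<dots> = real q * B q" using q_ge by (intro sum_sin_pi_div) auto
  finally show ?thesis .
qed

lemma sum_abs_sin_cos: "(\<Sum>i=1..<q. \<bar>cos (real i * \<theta>)\<bar> * \<bar>sin (real i * \<theta>)\<bar>) = real q * B q / 2"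
  using sum_theta_reindex[of "\<lambda>t. \<bar>cos t\<bar> * \<bar>sin t\<bar>"] sum_abs_sin_cos_pi_div by simp

section \<open>The loss over one period\<close>

text \<open>As \<open>q\<close> is odd, no multiple of \<open>pi / q\<close> is closer to
  \<open>pi / 2\<close> than \<open>pi / (2 * q)\<close>, and at that distance the cotangent has
  modulus \<open>tan (pi / (2 * q))\<close>. The two cases are the two sides of
  \<open>pi / 2\<close>.\<close>

lemma tan_half_le:
  assumes "m \<in> {1..<q}"
  shows "tan (pi / (2 * real q)) * sin (pi * real m / real q) \<le> \<bar>cos (pi * real m / real q)\<bar>"
proof -
  define h where "h = pi / (2 * real q)"
  define t where "t = pi * real m / real q"
  have h: "0 < h" "h < pi / 2" using q_ge by (auto simp: h_def field_simps)
  then have ch: "cos h > 0" by (intro cos_gt_zero) auto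
  have "sin h * sin t \<le> cos h * \<bar>cos t\<bar>"
  proof (cases "2 * m < q")
    case True
    then have "real (2 * m + 1) \<le> real q" by linarith
    then have "pi * real (2 * m + 1) \<le> pi * real q" by (intro mult_left_mono) auto
    then have "t + h \<le> pi / 2" using q_ge by (simp add: t_def h_def field_simps)
    moreover have "0 \<le> t" by (simp add: t_def)
    ultimately have "0 \<le> cos (t + h)" using h by (intro cos_ge_zero) auto
    then have "sin h * sin t \<le> cos h * cos t" by (simp add: cos_add mult.commute)
    also have "\<dots> \<le> cos h * \<bar>cos t\<bar>" using ch by (intro mult_left_mono) auto
    finally show ?thesis .
  next
    case False
    with odd_q have "2 * m \<ge> q + 1" by (metis Suc_eq_plus1 even_mult_iff even_numeral le_neq_implies_less not_less not_less_eq_eq)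
    then have "real (2 * m) \<ge> real (q + 1)" by linarith
    then have "pi * real (q + 1) \<le> pi * real (2 * m)" by (intro mult_left_mono) auto
    then have "pi / 2 \<le> t - h" using q_ge by (simp add: t_def h_def field_simps)
    moreover have "t < pi" using assms by (simp add: t_def field_simps)
    ultimately have "0 \<le> cos (pi - (t - h))" using h by (intro cos_ge_zero) auto
    then have "0 \<le> - (cos t * cos h + sin t * sin h)"
      by (simp only: cos_pi_minus cos_diff[of t h])
    then have "sin h * sin t \<le> cos h * (- cos t)"
      by (simp add: mult.commute)
    also have "\<dots> \<le> cos h * \<bar>cos t\<bar>" using ch by (intro mult_left_mono) auto
    finally show ?thesis .
  qed
  then show ?thesis using ch by (simp add: tan_def h_def t_def field_simps)
qed

text \<open>
  If the free solution \<open>y cos + D sin\<close> peaks at \<open>0\<close>, up to an error \<open>\<delta>\<close>, then \<open>D\<close> is so small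
  that pairing \<open>t\<close> with \<open>pi - t\<close> cancels its contribution.
\<close>

lemma sum_abs_free_solution_le:
  fixes y D \<delta> :: real
  assumes peak: "\<And>i. i \<in> {1..<q} \<Longrightarrow> \<bar>y * cos (real i * \<theta>) + D * sin (real i * \<theta>)\<bar> \<le> \<bar>y\<bar> + \<delta>"
    and "\<delta> \<ge> 0"
  shows "(\<Sum>i=1..<q. \<bar>y * cos (real i * \<theta>) + D * sin (real i * \<theta>)\<bar> * \<bar>sin (real i * \<theta>)\<bar>)
    \<le> \<bar>y\<bar> * (real q * B q / 2) + real q * \<delta> / sin (pi / real q)"
proof -
  define t where "t m = pi * real m / real q" for m
  define f where "f s = y * cos s + D * sin s" for s
  have per: "\<bar>f (s + pi)\<bar> = \<bar>f s\<bar>" for s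
    using abs_minus_cancel[of "f s"] by (simp add: f_def)
  \<comment> \<open>Every nonzero residue is some \<open>p * i mod q\<close>, so the bound carries
    over to the whole grid.\<close>
  have peak': "\<bar>f (t m)\<bar> \<le> \<bar>y\<bar> + \<delta>" if "m \<in> {1..<q}" for m
  proof -
    have "m \<in> (\<lambda>i. p * i mod q) ` {1..<q}"
      using bij_betw_imp_surj_on[OF mult_mod_bij_betw[OF coprime_pq]] that by simp
    then obtain i where i: "m = p * i mod q" "i \<in> {1..<q}"
      by (rule imageE)
    have "\<bar>f (t m)\<bar> = \<bar>f (real i * \<theta>)\<bar>"
      unfolding theta_multiple i(1) t_def using q_ge
      by (intro periodic_multiple_mod[of "\<lambda>s. \<bar>f s\<bar>", OF per, symmetric]) simp
    with peak[OF i(2)] show ?thesis by (simp add: f_def)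
  qed
  define x where "x = pi / real q"
  have x: "0 < x" "x < pi" using q_ge by (auto simp: x_def field_simps)
  then have sx: "sin x > 0" by (rule sin_gt_zero)
  \<comment> \<open>The grid points next to 0 and pi carry opposite signs of the cosine; the one
    where both terms have the same sign bounds \<open>D\<close>.\<close>
  have "\<bar>y * cos x + D * sin x\<bar> \<le> \<bar>y\<bar> + \<delta>"
    using peak'[of 1] q_ge by (simp add: f_def t_def x_def)
  moreover have "t (q - 1) = pi - x" using q_ge by (simp add: t_def x_def field_simps of_nat_diff)
  then have "\<bar>- y * cos x + D * sin x\<bar> \<le> \<bar>y\<bar> + \<delta>"
    using peak'[of "q - 1"] q_ge by (simp add: f_def)
  moreover have "\<bar>D\<bar> * sin x = \<bar>D * sin x\<bar>" using sx by (simp add: abs_mult)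
  moreover have "\<bar>y\<bar> * cos x \<le> \<bar>y * cos x\<bar>" by (simp add: abs_mult mult_left_mono)
  ultimately have "\<bar>D\<bar> * sin x \<le> \<bar>y\<bar> * (1 - cos x) + \<delta>" by (simp add: right_diff_distrib) linarith
  \<comment> \<open>\<open>x / 2\<close> is the angle in \<open>tan_half_le\<close>, so this form
    lets \<open>D * sin\<close> be compared with \<open>y * cos\<close> pointwise.\<close>
  also have "\<bar>y\<bar> * (1 - cos x) = \<bar>y\<bar> * tan (x / 2) * sin x"
  proof -
    have "cos (x / 2) > 0" using x by (intro cos_gt_zero) auto
    then have "tan (x / 2) * sin x = 2 * (sin (x / 2))\<^sup>2"
      using sin_double[of "x / 2"] by (simp add: tan_def power2_eq_square field_simps)
    also have "\<dots> = 1 - cos x" using cos_double_sin[of "x / 2"] by simp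
    finally show ?thesis by (simp add: mult.assoc)
  qed
  finally have D: "\<bar>D\<bar> \<le> \<bar>y\<bar> * tan (x / 2) + \<delta> / sin x" using sx by (simp add: field_simps)
  have st: "sin (t m) > 0" if "m \<in> {1..<q}" for m
    using that by (intro sin_gt_zero) (auto simp: t_def field_simps)
  \<comment> \<open>With \<open>a = y * cos (t m)\<close> and \<open>b = D * sin (t m)\<close> the
    two values of \<open>f\<close> are \<open>a + b\<close> and \<open>b - a\<close>, whose moduli
    add up to twice the larger of \<open>\<bar>a\<bar>\<close> and \<open>\<bar>b\<bar>\<close>. As
    \<open>\<bar>b\<bar>\<close> exceeds \<open>\<bar>a\<bar>\<close> by at most
    \<open>\<delta> / sin x\<close>, \<open>D\<close> drops out.\<close>
  have pair: "\<bar>f (t m)\<bar> * sin (t m) + \<bar>f (t (q - m))\<bar> * sin (t (q - m))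
      \<le> 2 * (\<bar>y\<bar> * (\<bar>cos (t m)\<bar> * \<bar>sin (t m)\<bar>) + \<delta> / sin x)" if m: "m \<in> {1..<q}" for m
  proof -
    have tq: "t (q - m) = pi - t m" using m by (simp add: t_def field_simps of_nat_diff)
    have "\<bar>D * sin (t m)\<bar> \<le> (\<bar>y\<bar> * tan (x / 2) + \<delta> / sin x) * sin (t m)"
      using D st[OF m] by (simp add: abs_mult mult_right_mono)
    also have "\<dots> = \<bar>y\<bar> * (tan (x / 2) * sin (t m)) + \<delta> / sin x * sin (t m)" by (simp add: algebra_simps)
    also have "\<dots> \<le> \<bar>y\<bar> * \<bar>cos (t m)\<bar> + \<delta> / sin x * 1"
      using tan_half_le[OF m] sx \<open>\<delta> \<ge> 0\<close>
      by (intro add_mono mult_left_mono) (auto simp: x_def t_def mult.commute)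
    finally have le: "\<bar>D * sin (t m)\<bar> \<le> \<bar>y * cos (t m)\<bar> + \<delta> / sin x" by (simp add: abs_mult)
    have nn: "\<delta> / sin x \<ge> 0" using sx \<open>\<delta> \<ge> 0\<close> by simp
    have "\<bar>f (t m)\<bar> + \<bar>f (t (q - m))\<bar> \<le> 2 * (\<bar>y * cos (t m)\<bar> + \<delta> / sin x)"
      using le nn by (simp add: f_def tq)
    then have "(\<bar>f (t m)\<bar> + \<bar>f (t (q - m))\<bar>) * sin (t m) \<le> 2 * (\<bar>y * cos (t m)\<bar> + \<delta> / sin x) * sin (t m)"
      using st[OF m] by (intro mult_right_mono) auto
    also have "\<dots> = 2 * (\<bar>y\<bar> * (\<bar>cos (t m)\<bar> * \<bar>sin (t m)\<bar>)) + 2 * (\<delta> / sin x * sin (t m))"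
      using st[OF m] by (simp add: abs_mult algebra_simps)
    also have "\<dots> \<le> 2 * (\<bar>y\<bar> * (\<bar>cos (t m)\<bar> * \<bar>sin (t m)\<bar>)) + 2 * (\<delta> / sin x * 1)"
      using nn by (intro add_mono mult_left_mono order_refl) auto
    finally show ?thesis by (simp add: tq algebra_simps)
  qed
  define F where "F m = \<bar>f (t m)\<bar> * sin (t m)" for m
  have rev: "(\<Sum>m=1..<q. F m) = (\<Sum>m=1..<q. F (q - m))"
    by (rule sum.reindex_bij_witness[of _ "\<lambda>m. q - m" "\<lambda>m. q - m"]) auto
  have "2 * (\<Sum>m=1..<q. F m) = (\<Sum>m=1..<q. F m + F (q - m))"
    using rev by (simp add: sum.distrib)
  also have "\<dots> \<le> (\<Sum>m=1..<q. 2 * (\<bar>y\<bar> * (\<bar>cos (t m)\<bar> * \<bar>sin (t m)\<bar>) + \<delta> / sin x))"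
    unfolding F_def by (rule sum_mono) (rule pair)
  also have "\<dots> = 2 * (\<bar>y\<bar> * (\<Sum>m=1..<q. \<bar>cos (t m)\<bar> * \<bar>sin (t m)\<bar>) + real (q - 1) * (\<delta> / sin x))"
    by (simp add: sum.distrib sum_distrib_left distrib_left)
  also have "\<dots> \<le> 2 * (\<bar>y\<bar> * (real q * B q / 2) + real q * (\<delta> / sin x))"
    unfolding t_def sum_abs_sin_cos_pi_div using sx \<open>\<delta> \<ge> 0\<close>
    by (intro mult_left_mono add_left_mono mult_right_mono) auto
  finally have "(\<Sum>m=1..<q. F m) \<le> \<bar>y\<bar> * (real q * B q / 2) + real q * (\<delta> / sin x)" by simp
  moreover have "(\<Sum>m=1..<q. F m) = (\<Sum>m=1..<q. \<bar>f (t m)\<bar> * \<bar>sin (t m)\<bar>)"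
    by (rule sum.cong) (simp_all only: F_def abs_of_pos[OF st])
  moreover have "\<dots> = (\<Sum>i=1..<q. \<bar>f (real i * \<theta>)\<bar> * \<bar>sin (real i * \<theta>)\<bar>)"
    using sum_theta_reindex[of "\<lambda>s. \<bar>f s\<bar> * \<bar>sin s\<bar>"] per by (simp add: t_def)
  ultimately show ?thesis by (simp add: f_def x_def)
qed

text \<open>The free part returns to \<open>x 0\<close> up to sign after \<open>q\<close> steps, so
  the loss is at most the perturbation term \<open>R q\<close>. Replacing \<open>x\<close> by the
  free part inside \<open>R q\<close> costs only second order in \<eta>, and
  \<open>sum_abs_free_solution_le\<close> bounds the rest.\<close>

lemma period_step:
  fixes x v :: "nat \<Rightarrow> real"
  assumes rec: "\<And>i. 1 \<le> i \<Longrightarrow> i < q \<Longrightarrow> x (i + 1) + x (i - 1) + v i * x i = 2 * cos \<theta> * x i"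
    and v: "\<And>i. 1 \<le> i \<Longrightarrow> i < q \<Longrightarrow> \<bar>v i\<bar> \<le> \<eta>"
    and x: "\<And>i. i < q \<Longrightarrow> \<bar>x i\<bar> \<le> \<bar>x 0\<bar>"
    and "\<eta> \<ge> 0"
  shows "\<bar>x q\<bar> \<ge> \<bar>x 0\<bar> * (1 - \<eta> / sin \<theta> *
    (real q * B q / 2 + (real q)\<^sup>2 / sin \<theta> * (1 / sin (pi / real q) + 1) * \<eta>))"
proof -
  \<comment> \<open>Chosen so that \<open>f\<close> agrees with \<open>x\<close> at 0 and 1.\<close>
  define D where "D = (x 1 - x 0 * cos \<theta>) / sin \<theta>"
  define f where "f i = x 0 * cos (real i * \<theta>) + D * sin (real i * \<theta>)" for i :: nat
  define R where "R j = (\<Sum>i=1..<j. v i * x i * sin ((real j - real i) * \<theta>)) / sin \<theta>" for j :: nat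
  \<comment> \<open>A crude bound for all \<open>R j\<close>: fewer than \<open>q\<close> impulses,
    each contributing at most \<open>\<eta> * \<bar>x 0\<bar> / sin \<theta>\<close>.\<close>
  define \<delta> where "\<delta> = real q * \<eta> / sin \<theta> * \<bar>x 0\<bar>"
  note st = sin_theta_pos
  have \<delta>: "\<delta> \<ge> 0" using st \<open>\<eta> \<ge> 0\<close> by (simp add: \<delta>_def)
  have xf: "x j = f j - R j" if "j \<le> q" for j
  proof -
    have "x j * sin \<theta> = x 0 * sin \<theta> * cos (real j * \<theta>)
        + (x 1 - x 0 * cos \<theta>) * sin (real j * \<theta>)
        + (\<Sum>i=1..<j. (- v i * x i) * sin ((real j - real i) * \<theta>))"
      by (rule variation_of_constants[OF _ that]) (use rec in force)
    also have "(\<Sum>i=1..<j. (- v i * x i) * sin ((real j - real i) * \<theta>)) = - (R j * sin \<theta>)"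
      using st by (simp add: R_def sum_negf)
    also have "(x 1 - x 0 * cos \<theta>) = D * sin \<theta>" using st by (simp add: D_def)
    finally have "x j * sin \<theta> = (f j - R j) * sin \<theta>" by (simp add: f_def algebra_simps)
    then show ?thesis using st by simp
  qed
  have vx: "\<bar>v i * x i\<bar> \<le> \<eta> * \<bar>x 0\<bar>" if "i \<in> {1..<q}" for i
    using v[of i] x[of i] that \<open>\<eta> \<ge> 0\<close> by (auto simp: abs_mult intro!: mult_mono)
  have R: "\<bar>R j\<bar> \<le> \<delta>" if "j \<le> q" for j
  proof -
    have "\<bar>\<Sum>i=1..<j. v i * x i * sin ((real j - real i) * \<theta>)\<bar>
        \<le> (\<Sum>i=1..<j. \<bar>v i * x i * sin ((real j - real i) * \<theta>)\<bar>)" by (rule sum_abs)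
    also have "\<dots> \<le> (\<Sum>i=1..<j. \<eta> * \<bar>x 0\<bar> * 1)"
    proof (rule sum_mono)
      fix i assume "i \<in> {1..<j}"
      then have "\<bar>v i * x i\<bar> \<le> \<eta> * \<bar>x 0\<bar>" using that by (intro vx) auto
      then show "\<bar>v i * x i * sin ((real j - real i) * \<theta>)\<bar> \<le> \<eta> * \<bar>x 0\<bar> * 1"
        unfolding abs_mult[of "v i * x i"] using \<open>\<eta> \<ge> 0\<close> by (intro mult_mono) auto
    qed
    also have "\<dots> = real (j - 1) * (\<eta> * \<bar>x 0\<bar>)" by simp
    also have "\<dots> \<le> real q * (\<eta> * \<bar>x 0\<bar>)"
      using that \<open>\<eta> \<ge> 0\<close> by (intro mult_right_mono) auto
    finally show ?thesis using st by (simp add: R_def \<delta>_def abs_mult field_simps)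
  qed
  have peak: "\<bar>f i\<bar> \<le> \<bar>x 0\<bar> + \<delta>" if "i \<in> {1..<q}" for i
    using xf[of i] R[of i] x[of i] that by auto
  have "\<bar>R q * sin \<theta>\<bar> \<le> (\<Sum>i=1..<q. \<bar>v i * x i * sin ((real q - real i) * \<theta>)\<bar>)"
    unfolding R_def using st by (simp add: sum_abs)
  also have "\<dots> \<le> (\<Sum>i=1..<q. \<eta> * (\<bar>f i\<bar> * \<bar>sin (real i * \<theta>)\<bar> + \<delta>))"
  proof (rule sum_mono)
    fix i assume i: "i \<in> {1..<q}"
    have "\<bar>v i * x i * sin ((real q - real i) * \<theta>)\<bar> = \<bar>v i\<bar> * (\<bar>x i\<bar> * \<bar>sin (real i * \<theta>)\<bar>)"
      by (simp add: sin_q_theta_minus abs_mult)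
    also have "\<dots> \<le> \<eta> * (\<bar>x i\<bar> * \<bar>sin (real i * \<theta>)\<bar>)"
      using v[of i] i by (intro mult_right_mono) auto
    also have "\<bar>x i\<bar> * \<bar>sin (real i * \<theta>)\<bar> \<le> (\<bar>f i\<bar> + \<delta>) * \<bar>sin (real i * \<theta>)\<bar>"
      using xf[of i] R[of i] i by (intro mult_right_mono) auto
    also have "\<dots> \<le> \<bar>f i\<bar> * \<bar>sin (real i * \<theta>)\<bar> + \<delta> * 1"
      unfolding distrib_right using \<delta> by (intro add_left_mono mult_left_mono) auto
    finally show "\<bar>v i * x i * sin ((real q - real i) * \<theta>)\<bar> \<le> \<eta> * (\<bar>f i\<bar> * \<bar>sin (real i * \<theta>)\<bar> + \<delta>)"
      using \<open>\<eta> \<ge> 0\<close> by (simp add: mult_left_mono)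
  qed
  also have "\<dots> = \<eta> * ((\<Sum>i=1..<q. \<bar>f i\<bar> * \<bar>sin (real i * \<theta>)\<bar>) + real (q - 1) * \<delta>)"
    by (simp add: sum_distrib_left[symmetric] sum.distrib)
  also have "\<dots> \<le> \<eta> * ((\<bar>x 0\<bar> * (real q * B q / 2) + real q * \<delta> / sin (pi / real q)) + real q * \<delta>)"
    using sum_abs_free_solution_le[OF peak[unfolded f_def] \<delta>] \<delta> \<open>\<eta> \<ge> 0\<close>
    unfolding f_def by (intro mult_left_mono add_mono mult_right_mono) auto
  also have "\<dots> = \<bar>x 0\<bar> * (\<eta> * (real q * B q / 2 + (real q)\<^sup>2 / sin \<theta> * (1 / sin (pi / real q) + 1) * \<eta>))"
    by (simp add: \<delta>_def algebra_simps power2_eq_square)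
  finally have "\<bar>R q\<bar> \<le> \<bar>x 0\<bar> * (\<eta> / sin \<theta> * (real q * B q / 2 + (real q)\<^sup>2 / sin \<theta> * (1 / sin (pi / real q) + 1) * \<eta>))"
    using st by (simp add: abs_mult pos_le_divide_eq[symmetric])
  moreover have "\<bar>f q\<bar> = \<bar>x 0\<bar>" by (simp add: f_def sin_q_theta cos_q_theta abs_mult)
  ultimately show ?thesis
    using xf[of q] by (simp add: right_diff_distrib)
qed

section \<open>Failure of square summability below the threshold\<close>

lemma not_square_summable:
  fixes u V :: "nat \<Rightarrow> real"
  assumes small: "eventually (\<lambda>n. \<bar>real n * V n\<bar> \<le> a) sequentially"
    and a: "0 \<le> a" "a < sin \<theta> / B q"
    and rec: "\<And>n. 1 \<le> n \<Longrightarrow> u (n + 1) + u (n - 1) + V n * u n = 2 * cos \<theta> * u n"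
    and nz: "u n0 \<noteq> 0"
  shows "\<not> summable (\<lambda>n. (u n)\<^sup>2)"
proof
  assume sm: "summable (\<lambda>n. (u n)\<^sup>2)"
  \<comment> \<open>Two adjacent zeros spread both ways through the recurrence and force
    \<open>u = 0\<close>; hence no block peak vanishes.\<close>
  have zero: "\<not> (u n = 0 \<and> u (n + 1) = 0)" for n
  proof
    assume z: "u n = 0 \<and> u (n + 1) = 0"
    have up: "u (n + m) = 0 \<and> u (n + m + 1) = 0" for m
    proof (induction m)
      case (Suc m)
      then show ?case using rec[of "n + m + 1"] by simp
    qed (use z in simp)
    have down: "m \<le> n \<Longrightarrow> u (n - m) = 0 \<and> u (n - m + 1) = 0" for m
    proof (induction m)
      case (Suc m)
      then have "n - m - 1 = n - Suc m" "n - Suc m + 1 = n - m" "1 \<le> n - m" by auto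
      then show ?case using rec[of "n - m"] Suc by simp
    qed (use z in simp)
    show False using up[of "n0 - n"] down[of "n - n0"] nz by (cases "n \<le> n0") auto
  qed
  define K where "K = (real q)\<^sup>2 / sin \<theta> * (1 / sin (pi / real q) + 1)"
  define M where "M l = Max ((\<lambda>i. \<bar>u (l * q + i)\<bar>) ` {..<q})" for l
  have q0: "0 \<in> {..<q}" "1 \<in> {..<q}" using q_ge by auto
  have M_ge: "\<bar>u (l * q + i)\<bar> \<le> M l" if "i < q" for l i
    unfolding M_def using that by (intro Max_ge) auto
  have M_pos: "M l > 0" for l
    using zero[of "l * q"] M_ge[of 0 l] M_ge[of 1 l] q_ge by auto
  \<comment> \<open>The relative loss over a period, times its start \<open>m\<close>, has a limit
    strictly below \<open>q / 2\<close>; the slack absorbs the second-order term.\<close>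
  have "(\<lambda>m. a / sin \<theta> * (real q * B q / 2 + K * (a / real m))) \<longlonglongrightarrow> a / sin \<theta> * (real q * B q / 2 + K * 0)"
    by (intro tendsto_intros lim_const_over_n)
  moreover have "a / sin \<theta> * (real q * B q / 2 + K * 0) < real q / 2"
    using a(2) B_pos sin_theta_pos q_ge by (simp add: field_simps)
  ultimately have "eventually (\<lambda>m. a / sin \<theta> * (real q * B q / 2 + K * (a / real m)) < real q / 2) sequentially"
    by (rule order_tendstoD)
  with small have "eventually (\<lambda>m. \<bar>real m * V m\<bar> \<le> a
      \<and> a / sin \<theta> * (real q * B q / 2 + K * (a / real m)) < real q / 2) sequentially"
    by (rule eventually_conj)
  then obtain N where N: "\<And>m. m \<ge> N \<Longrightarrow> \<bar>real m * V m\<bar> \<le> a"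
    "\<And>m. m \<ge> N \<Longrightarrow> a / sin \<theta> * (real q * B q / 2 + K * (a / real m)) < real q / 2"
    unfolding eventually_sequentially by blast
  have M_step: "M (Suc l) \<ge> M l * (1 - 1 / (2 * real l))" if l: "l \<ge> Suc N" for l
  proof -
    have le: "M l * (1 - 1 / (2 * real l)) \<le> M l" using M_pos[of l] by (simp add: mult_le_cancel_left1)
    have "M l \<in> (\<lambda>i. \<bar>u (l * q + i)\<bar>) ` {..<q}" unfolding M_def using q0 by (intro Max_in) auto
    then obtain r where r: "r < q" "M l = \<bar>u (l * q + r)\<bar>" by auto
    define m where "m = l * q + r"
    have "l * 1 \<le> l * q" using q_ge by (intro mult_left_mono) auto
    then have m: "m \<ge> N" "m > 0" using l unfolding m_def by linarith+
    have next_block: "\<bar>u (m + i)\<bar> \<le> M (Suc l)" if "i \<le> q" "r + i \<ge> q" for i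
      using M_ge[of "r + i - q" "Suc l"] that r(1) by (simp add: m_def algebra_simps)
    \<comment> \<open>If the period starting at the peak \<open>m\<close> reaches \<open>M l\<close>
      inside the next block, nothing is lost. Otherwise \<open>m\<close> dominates the period, and
      \<open>period_step\<close> bounds the value at \<open>m + q\<close>, which lies in the next
      block.\<close>
    show ?thesis
    proof (cases "\<exists>i. i < q \<and> r + i \<ge> q \<and> \<bar>u (m + i)\<bar> \<ge> M l")
      case True
      then obtain i where "i < q" "r + i \<ge> q" "\<bar>u (m + i)\<bar> \<ge> M l" by blast
      then show ?thesis using next_block[of i] le by linarith
    next
      case False
      have peak: "\<bar>u (m + i)\<bar> \<le> \<bar>u (m + 0)\<bar>" if "i < q" for i
      proof (cases "r + i < q")
        case True
        then show ?thesis using M_ge[of "r + i" l] r(2) by (simp add: m_def add.assoc)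
      next
        case F: False
        then have "\<not> \<bar>u (m + i)\<bar> \<ge> M l" using False that by auto
        then show ?thesis by (simp add: r(2) m_def)
      qed
      have small_V: "\<bar>V (m + i)\<bar> \<le> a / real m" for i
      proof -
        have "real m * \<bar>V (m + i)\<bar> \<le> real (m + i) * \<bar>V (m + i)\<bar>" by (intro mult_right_mono) auto
        also have "\<dots> \<le> a" using N(1)[of "m + i"] m by (simp add: abs_mult)
        finally show ?thesis using m by (simp add: field_simps)
      qed
      have "\<bar>u (m + 0)\<bar> * (1 - a / real m / sin \<theta> * (real q * B q / 2 + K * (a / real m))) \<le> \<bar>u (m + q)\<bar>"
        unfolding K_def
      proof (rule period_step)
        show "u (m + (i + 1)) + u (m + (i - 1)) + V (m + i) * u (m + i) = 2 * cos \<theta> * u (m + i)" if "1 \<le> i" for i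
          using rec[of "m + i"] that by (simp add: add.assoc)
      qed (use peak small_V a in auto)
      also have "\<dots> \<le> M (Suc l)" using r(1) by (intro next_block) auto
      finally have "M l * (1 - a / real m / sin \<theta> * (real q * B q / 2 + K * (a / real m))) \<le> M (Suc l)"
        using r(2) by (simp add: m_def)
      moreover have "a / real m / sin \<theta> * (real q * B q / 2 + K * (a / real m)) \<le> 1 / (2 * real l)"
      proof -
        have "a / real m / sin \<theta> * (real q * B q / 2 + K * (a / real m))
            = a / sin \<theta> * (real q * B q / 2 + K * (a / real m)) / real m" by simp
        also have "\<dots> \<le> real q / 2 / real m" using N(2)[OF m(1)] m(2) by (intro divide_right_mono) auto
        also have "\<dots> \<le> real q / 2 / real (l * q)"
        proof -
          have "0 < l * q" "l * q \<le> m" using l q_ge by (simp_all add: m_def)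
          then show ?thesis using m(2) by (intro divide_left_mono mult_pos_pos) (auto simp del: of_nat_mult)
        qed
        also have "\<dots> = 1 / (2 * real l)" using q_ge by simp
        finally show ?thesis .
      qed
      then have "M l * (1 - 1 / (2 * real l))
          \<le> M l * (1 - a / real m / sin \<theta> * (real q * B q / 2 + K * (a / real m)))"
        using M_pos[of l] by (intro mult_left_mono) auto
      ultimately show ?thesis by linarith
    qed
  qed
  define c where "c = real (Suc N) * (M (Suc (Suc N)))\<^sup>2"
  have c: "c > 0" using M_pos[of "Suc (Suc N)"] by (simp add: c_def)
  have mono: "c \<le> (real l - 1) * (M l)\<^sup>2" if "l \<ge> Suc (Suc N)" for l
    using that
  proof (induction l rule: dec_induct)
    case base
    then show ?case by (simp add: c_def)
  next
    case (step l)
    have l: "real l \<ge> 2" using step by simp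
    \<comment> \<open>The square expands to
      \<open>l * (1 - 1 / (2 * l))^2 = l - 1 + 1 / (4 * l)\<close>, which is why the weight
      \<open>l - 1\<close> gives a nondecreasing quantity.\<close>
    have "(real l - 1) \<le> real l * (1 - 1 / (2 * real l))\<^sup>2"
      using l by (simp add: power2_eq_square field_simps)
    then have "(real l - 1) * (M l)\<^sup>2 \<le> real l * (1 - 1 / (2 * real l))\<^sup>2 * (M l)\<^sup>2"
      by (intro mult_right_mono) auto
    also have "\<dots> = real l * (M l * (1 - 1 / (2 * real l)))\<^sup>2" by (simp add: power_mult_distrib)
    also have "\<dots> \<le> real l * (M (Suc l))\<^sup>2"
      using l step M_pos[of l] by (intro mult_left_mono power_mono M_step) (auto simp: field_simps)
    finally show ?case using step.IH by simp
  qed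
  have block: "(M l)\<^sup>2 \<le> sum (\<lambda>n. (u n)\<^sup>2) {l * q..<l * q + q}" for l
  proof -
    have "M l \<in> (\<lambda>i. \<bar>u (l * q + i)\<bar>) ` {..<q}" unfolding M_def using q0 by (intro Max_in) auto
    then obtain r where r: "r < q" "M l = \<bar>u (l * q + r)\<bar>" by auto
    then show ?thesis
      using member_le_sum[of "l * q + r" "{l * q..<l * q + q}" "\<lambda>n. (u n)\<^sup>2"] by simp
  qed
  have "summable (\<lambda>l. sum (\<lambda>n. (u n)\<^sup>2) {l * q..<l * q + q})"
    using sums_group[OF summable_sums[OF sm], of q] q_ge by (auto simp: sums_iff)
  then have "summable (\<lambda>l. c * inverse (real l))"
  proof (rule summable_comparison_test'[where N = "Suc (Suc N)"])
    fix l assume l: "l \<ge> Suc (Suc N)"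
    have "c \<le> real l * (M l)\<^sup>2"
      using mono[OF l] by (rule order_trans) (intro mult_right_mono, auto)
    then have "c * inverse (real l) \<le> (M l)\<^sup>2" using l by (simp add: field_simps)
    with block[of l] show "norm (c * inverse (real l)) \<le> sum (\<lambda>n. (u n)\<^sup>2) {l * q..<l * q + q}"
      using c by simp
  qed
  then have "summable (\<lambda>l. inverse (real l))" using c by (simp add: summable_cmult_iff)
  then show False using not_summable_harmonic[where 'a = real] by simp
qed

section \<open>The extremal block\<close>

text \<open>A zero would make \<open>2 * p * j\<close> an odd multiple of the odd number
  \<open>q\<close>. Thus small corrections to the cosine keep the constructed solution
  nonzero.\<close>

lemma cos_theta_multiple_nonzero: "cos (real j * \<theta>) \<noteq> 0"
proof
  assume "cos (real j * \<theta>) = 0"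
  then obtain i :: int where i: "odd i" "real j * \<theta> = of_int i * (pi / 2)"
    unfolding cos_zero_iff_int by blast
  then have "2 * real p * real j = of_int i * real q"
    using q_ge by (simp add: theta field_simps)
  then have "of_int (2 * int p * int j) = (of_int (i * int q) :: real)" by simp
  then have "2 * int p * int j = i * int q" by (simp only: of_int_eq_iff)
  then have "even (i * int q)" by (metis dvd_triv_left mult.assoc)
  then show False using i(1) odd_q by simp
qed

text \<open>This choice gives all terms of the first-order sum at site \<open>q\<close> the same
  sign, the equality case of the loss bound. As \<open>sgn 0 = 0\<close>, it vanishes at
  \<open>i = 0\<close>, where blocks join.\<close>

definition phase_sign :: "nat \<Rightarrow> real" where
  "phase_sign i = sgn (cos (real i * \<theta>) * sin (real i * \<theta>))"

text \<open>
  First-order response of the free solution \<open>cos (j \<theta>)\<close> to the potential \<open>phase_sign\<close>.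
\<close>

fun corrector :: "nat \<Rightarrow> real" where
  "corrector 0 = 0"
| "corrector (Suc 0) = 0"
| "corrector (Suc (Suc n)) = 2 * cos \<theta> * corrector (Suc n) - corrector n
    - phase_sign (Suc n) * cos (real (Suc n) * \<theta>)"

lemma corrector_rec:
  assumes "1 \<le> j"
  shows "corrector (j + 1) + corrector (j - 1) = 2 * cos \<theta> * corrector j - phase_sign j * cos (real j * \<theta>)"
  using assms by (cases j) auto

lemma corrector_sum:
  "corrector j * sin \<theta> = - (\<Sum>i=1..<j. phase_sign i * cos (real i * \<theta>) * sin ((real j - real i) * \<theta>))"
proof -
  have "corrector j * sin \<theta> = corrector 0 * sin \<theta> * cos (real j * \<theta>)
      + (corrector 1 - corrector 0 * cos \<theta>) * sin (real j * \<theta>)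
      + (\<Sum>i=1..<j. (- phase_sign i * cos (real i * \<theta>)) * sin ((real j - real i) * \<theta>))"
    by (rule variation_of_constants[OF _ order_refl]) (use corrector_rec in force)
  then show ?thesis by (simp add: sum_negf)
qed

lemma sum_phase_sign: "(\<Sum>i=1..<q. phase_sign i * cos (real i * \<theta>) * sin (real i * \<theta>)) = real q * B q / 2"
proof -
  have "phase_sign i * cos (real i * \<theta>) * sin (real i * \<theta>) = \<bar>cos (real i * \<theta>)\<bar> * \<bar>sin (real i * \<theta>)\<bar>" for i
  proof -
    have "sgn t * t = \<bar>t\<bar>" for t :: real by (simp add: abs_sgn)
    from this[of "cos (real i * \<theta>) * sin (real i * \<theta>)"] show ?thesis
      by (simp only: phase_sign_def mult.assoc abs_mult)
  qed
  then show ?thesis using sum_abs_sin_cos by simp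
qed

text \<open>Under \<open>i\<close> to \<open>q - i\<close> the sign is odd and the squared cosine
  even. This sum measures the phase shift over a block, so the next block starts in the same
  phase.\<close>

lemma sum_phase_sign_cos_sq: "(\<Sum>i=1..<q. phase_sign i * (cos (real i * \<theta>))\<^sup>2) = 0"
proof -
  define F where "F i = phase_sign i * (cos (real i * \<theta>))\<^sup>2" for i
  have "F (q - i) = - F i" if "i \<in> {1..<q}" for i
  proof -
    have r: "real (q - i) = real q - real i" using that by (simp add: of_nat_diff)
    have "(-1) ^ p * cos (real i * \<theta>) * - ((-1) ^ p * sin (real i * \<theta>)) = - (cos (real i * \<theta>) * sin (real i * \<theta>))"
      by (simp add: power_add[symmetric] mult_ac)
    then have "phase_sign (q - i) = - phase_sign i"
      unfolding phase_sign_def r sin_q_theta_minus cos_q_theta_minus by (simp only: sgn_minus)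
    then show ?thesis
      by (simp add: F_def r cos_q_theta_minus power_mult_distrib flip: power_mult)
  qed
  moreover have "(\<Sum>i=1..<q. F i) = (\<Sum>i=1..<q. F (q - i))"
    by (rule sum.reindex_bij_witness[of _ "\<lambda>m. q - m" "\<lambda>m. q - m"]) auto
  ultimately have "(\<Sum>i=1..<q. F i) = - (\<Sum>i=1..<q. F i)" by (simp add: sum_negf)
  then show ?thesis by (simp add: F_def)
qed

text \<open>Relative change of amplitude over a block per unit of coupling; the same constant as the
  first-order loss in \<open>period_step\<close>.\<close>

definition gain :: real where
  "gain = real q * B q / (2 * sin \<theta>)"

lemma gain_pos: "gain > 0"
  using B_pos sin_theta_pos q_ge by (simp add: gain_def)

lemma corrector_q: "corrector q = (-1) ^ p * gain"
proof -
  have "corrector q * sin \<theta> = - (\<Sum>i=1..<q. - ((-1) ^ p) * (phase_sign i * cos (real i * \<theta>) * sin (real i * \<theta>)))"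
    unfolding corrector_sum sin_q_theta_minus by (simp add: mult_ac)
  also have "\<dots> = (-1) ^ p * (real q * B q / 2)"
    unfolding sum_distrib_left[symmetric] sum_phase_sign by simp
  finally show ?thesis using sin_theta_pos by (simp add: gain_def field_simps)
qed

text \<open>Together with \<open>corrector_q\<close>: at sites \<open>q - 1\<close> and
  \<open>q\<close> the corrector is \<open>gain\<close> times the cosine, so a corrected block ends
  as a rescaled cosine.\<close>

lemma corrector_q_minus: "corrector (q - 1) = (-1) ^ p * (cos \<theta> * gain)"
proof -
  \<comment> \<open>The index \<open>q - 1\<close> may be added to the sum because its kernel is
    \<open>sin 0\<close>.\<close>
  have q1: "{1..<q} = insert (q - 1) {1..<q - 1}" using q_ge by auto
  have r: "real (q - 1) = real q - 1" using q_ge by simp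
  have "corrector (q - 1) * sin \<theta>
      = - (\<Sum>i=1..<q. phase_sign i * cos (real i * \<theta>) * sin ((real (q - 1) - real i) * \<theta>))"
    unfolding corrector_sum q1 by simp
  also have "(\<Sum>i=1..<q. phase_sign i * cos (real i * \<theta>) * sin ((real (q - 1) - real i) * \<theta>))
      = (\<Sum>i=1..<q. - ((-1) ^ p) * (cos \<theta> * (phase_sign i * cos (real i * \<theta>) * sin (real i * \<theta>))
         + sin \<theta> * (phase_sign i * (cos (real i * \<theta>))\<^sup>2)))"
  proof (rule sum.cong[OF refl])
    fix i
    have "sin ((real (q - 1) - real i) * \<theta>) = sin ((real q - real i) * \<theta> - \<theta>)"
      by (simp only: r) (simp add: algebra_simps)
    also have "\<dots> = - ((-1) ^ p) * (sin (real i * \<theta>) * cos \<theta> + cos (real i * \<theta>) * sin \<theta>)"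
      unfolding sin_diff[of _ \<theta>] sin_q_theta_minus cos_q_theta_minus by (simp add: algebra_simps)
    finally have e: "sin ((real (q - 1) - real i) * \<theta>) = \<dots>" .
    show "phase_sign i * cos (real i * \<theta>) * sin ((real (q - 1) - real i) * \<theta>)
      = - ((-1) ^ p) * (cos \<theta> * (phase_sign i * cos (real i * \<theta>) * sin (real i * \<theta>))
         + sin \<theta> * (phase_sign i * (cos (real i * \<theta>))\<^sup>2))"
      unfolding e by (simp add: algebra_simps power2_eq_square)
  qed
  also have "- \<dots> = (-1) ^ p * (cos \<theta> * (real q * B q / 2))"
    unfolding sum_distrib_left[symmetric] sum.distrib sum_phase_sign sum_phase_sign_cos_sq by simp
  finally show ?thesis using sin_theta_pos by (simp add: gain_def field_simps)
qed

text \<open>Inside a block the recurrences of cosine and corrector combine linearly. At a join both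
  sides are multiples of the same cosine, and \<open>phase_sign 0 = 0\<close>.\<close>

lemma block_solution_rec:
  fixes c P w :: "nat \<Rightarrow> real"
  assumes P: "\<And>l. P (Suc l) = P l * (1 + c l * gain)"
    and w: "\<And>n. w n = (-1) ^ (p * (n div q)) * P (n div q)
      * (cos (real (n mod q) * \<theta>) + c (n div q) * corrector (n mod q))"
    and "1 \<le> n"
  shows "w (n + 1) + w (n - 1) = 2 * cos \<theta> * w n - (-1) ^ (p * (n div q)) * P (n div q)
    * (c (n div q) * phase_sign (n mod q) * cos (real (n mod q) * \<theta>))"
proof -
  \<comment> \<open>The formula extends to \<open>j = q\<close>, one site past the block, by the
    relation between \<open>P (Suc l)\<close> and \<open>P l\<close>.\<close>
  have wl: "w (l * q + j) = (-1) ^ (p * l) * P l * (cos (real j * \<theta>) + c l * corrector j)" if "j \<le> q" for l j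
  proof (cases "j = q")
    case True
    then have "w (l * q + j) = w (Suc l * q)" by (simp add: add.commute)
    also have "\<dots> = (-1) ^ (p * Suc l) * P (Suc l)" unfolding w using q_ge by simp
    also have "\<dots> = (-1) ^ (p * l) * P l * ((-1) ^ p + c l * ((-1) ^ p * gain))"
      by (simp add: P power_add algebra_simps)
    finally show ?thesis by (simp add: True corrector_q cos_q_theta)
  next
    case False
    then show ?thesis using that by (simp add: w)
  qed
  define l j where "l = n div q" and "j = n mod q"
  have n: "n = l * q + j" and j: "j < q" using q_ge by (simp_all add: l_def j_def)
  show ?thesis
  proof (cases "j = 0")
    case False
    then have "n + 1 = l * q + (j + 1)" "n - 1 = l * q + (j - 1)" using n by auto
    then have e: "w (n + 1) = (-1) ^ (p * l) * P l * (cos (real (j + 1) * \<theta>) + c l * corrector (j + 1))"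
      "w (n - 1) = (-1) ^ (p * l) * P l * (cos (real (j - 1) * \<theta>) + c l * corrector (j - 1))"
      "w n = (-1) ^ (p * l) * P l * (cos (real j * \<theta>) + c l * corrector j)"
      using j n by (simp_all only: wl)
    have "w (n + 1) + w (n - 1) = (-1) ^ (p * l) * P l
        * ((cos (real (j + 1) * \<theta>) + cos (real (j - 1) * \<theta>)) + c l * (corrector (j + 1) + corrector (j - 1)))"
      unfolding e by (simp only: distrib_left add_ac)
    also have "cos (real (j + 1) * \<theta>) + cos (real (j - 1) * \<theta>) = 2 * cos \<theta> * cos (real j * \<theta>)"
      using False cos_add[of "real j * \<theta>" \<theta>] cos_diff[of "real j * \<theta>" \<theta>]
      by (simp add: of_nat_diff algebra_simps)
    also have "corrector (j + 1) + corrector (j - 1) = 2 * cos \<theta> * corrector j - phase_sign j * cos (real j * \<theta>)"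
      using False by (intro corrector_rec) simp
    finally show ?thesis
      unfolding e(3) l_def[symmetric] j_def[symmetric] by (simp add: algebra_simps)
  next
    case True
    then obtain l' where l': "l = Suc l'" using n \<open>1 \<le> n\<close> by (cases l) auto
    have "n - 1 = l' * q + (q - 1)" using n True l' q_ge by simp
    then have "w (n - 1) = (-1) ^ (p * l') * P l' * (cos (real (q - 1) * \<theta>) + c l' * corrector (q - 1))"
      by (simp add: wl)
    also have "cos (real (q - 1) * \<theta>) = (-1) ^ p * cos \<theta>"
      using cos_q_theta_minus[of 1] q_ge by (simp add: of_nat_diff)
    also have "(-1) ^ (p * l') * P l' * ((-1) ^ p * cos \<theta> + c l' * corrector (q - 1)) = (-1) ^ (p * l) * P l * cos \<theta>"
      unfolding corrector_q_minus l' by (simp add: P power_add algebra_simps)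
    moreover have "w (n + 1) = (-1) ^ (p * l) * P l * cos \<theta>"
      using wl[of 1 l] n True q_ge by simp
    moreover have "w n = (-1) ^ (p * l) * P l" using wl[of 0 l] n True by simp
    ultimately show ?thesis
      using True by (simp add: l_def[symmetric] j_def[symmetric] phase_sign_def)
  qed
qed

section \<open>A square-summable solution above the threshold\<close>

lemma decaying_block_solution:
  assumes C: "sin \<theta> / B q < C"
  obtains w :: "nat \<Rightarrow> real" where "\<And>n. w n \<noteq> 0" "summable (\<lambda>n. (w n)\<^sup>2)"
    "eventually (\<lambda>n. \<bar>real n * (2 * cos \<theta> - (w (n + 1) + w (n - 1)) / w n)\<bar> \<le> C) sequentially"
proof -
  obtain a where a: "sin \<theta> / B q < a" "a < C" using dense[OF C] by blast
  have "sin \<theta> / B q > 0" using sin_theta_pos B_pos by simp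
  then have a0: "a > 0" using a(1) by linarith
  \<comment> \<open>If \<open>P l\<close> decays like \<open>l powr - \<kappa>\<close>, the coupling
    is about \<open>- \<kappa> / (gain * l)\<close>; as \<open>n\<close> is about
    \<open>q * l\<close>, the potential has size \<open>q * \<kappa> / gain\<close>, which is
    \<open>a\<close> for this \<kappa>. Then \<open>a > sin \<theta> / B q\<close> says
    \<open>\<kappa> > 1 / 2\<close>, that is, square summability.\<close>
  define \<kappa> where "\<kappa> = a * gain / real q"
  have \<kappa>: "\<kappa> > 1 / 2"
    using a(1) B_pos sin_theta_pos q_ge by (simp add: \<kappa>_def gain_def field_simps)
  \<comment> \<open>The exact solution of \<open>P (Suc l) = P l * (1 + c l * gain)\<close> for the
    coupling, before the shift by \<open>L\<close>.\<close>
  define \<gamma> where "\<gamma> l = (real (Suc l) powr - \<kappa> / real l powr - \<kappa> - 1) / gain" for l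
  have \<gamma>_lim: "(\<lambda>l. real l * \<gamma> l) \<longlonglongrightarrow> - (\<kappa> / gain)"
  proof -
    have "(\<lambda>l. real l * (real (Suc l) powr - \<kappa> / real l powr - \<kappa> - 1)) \<longlonglongrightarrow> - \<kappa>"
      unfolding of_nat_Suc by real_asymp
    then have "(\<lambda>l. real l * (real (Suc l) powr - \<kappa> / real l powr - \<kappa> - 1) / gain) \<longlonglongrightarrow> - \<kappa> / gain"
      using gain_pos by (intro tendsto_divide tendsto_const) auto
    then show ?thesis by (simp add: \<gamma>_def)
  qed
  have "(\<lambda>l. real l * \<gamma> l * (1 / real l)) \<longlonglongrightarrow> 0"
    using tendsto_mult[OF \<gamma>_lim lim_1_over_n] by (simp only: mult_zero_right)
  then have \<gamma>0: "\<gamma> \<longlonglongrightarrow> 0"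
    by (rule Lim_transform_eventually) (rule eventually_sequentiallyI[of 1], simp)
  have "\<forall>j\<in>{..<q}. eventually (\<lambda>l. \<bar>\<gamma> l * corrector j\<bar> < \<bar>cos (real j * \<theta>)\<bar>) sequentially"
  proof
    fix j
    have "(\<lambda>l. \<bar>\<gamma> l * corrector j\<bar>) \<longlonglongrightarrow> \<bar>0 * corrector j\<bar>" by (intro tendsto_intros \<gamma>0)
    then show "eventually (\<lambda>l. \<bar>\<gamma> l * corrector j\<bar> < \<bar>cos (real j * \<theta>)\<bar>) sequentially"
      by (rule order_tendstoD) (simp add: cos_theta_multiple_nonzero)
  qed
  then have "eventually (\<lambda>l. \<forall>j\<in>{..<q}. \<bar>\<gamma> l * corrector j\<bar> < \<bar>cos (real j * \<theta>)\<bar>) sequentially"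
    by (intro eventually_ball_finite) auto
  then obtain L' where L': "\<And>l j. l \<ge> L' \<Longrightarrow> j < q \<Longrightarrow> \<bar>\<gamma> l * corrector j\<bar> < \<bar>cos (real j * \<theta>)\<bar>"
    unfolding eventually_sequentially by auto
  \<comment> \<open>The shift skips the blocks whose correction could cancel a cosine; the successor
    keeps the base of the power positive.\<close>
  define L where "L = Suc L'"
  define c where "c l = \<gamma> (l + L)" for l
  define P where "P l = real (l + L) powr - \<kappa>" for l
  define w where "w n = (-1) ^ (p * (n div q)) * P (n div q)
      * (cos (real (n mod q) * \<theta>) + c (n div q) * corrector (n mod q))" for n
  have P_pos: "P l > 0" for l by (simp add: P_def L_def)
  have P_Suc: "P (Suc l) = P l * (1 + c l * gain)" for l
    using P_pos[of l] gain_pos by (simp add: P_def c_def \<gamma>_def)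
  have small: "\<bar>c l * corrector j\<bar> < \<bar>cos (real j * \<theta>)\<bar>" if "j < q" for l j
    unfolding c_def using that by (intro L') (auto simp: L_def)
  have \<phi>_nz: "cos (real j * \<theta>) + c l * corrector j \<noteq> 0" if "j < q" for l j
    using small[OF that, of l] by auto
  have mod: "n mod q < q" for n using q_ge by simp
  have w_nz: "w n \<noteq> 0" for n
    using P_pos[of "n div q"] \<phi>_nz[OF mod, of n] by (simp add: w_def)
  moreover have "summable (\<lambda>n. (w n)\<^sup>2)"
  proof (rule summable_comparison_test'[where N = 1])
    show "summable (\<lambda>n. 4 * real q powr (2 * \<kappa>) * real n powr (- 2 * \<kappa>))"
      using \<kappa> by (intro summable_mult) (simp add: summable_real_powr_iff)
    fix n :: nat assume n: "n \<ge> 1"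
    define l j where "l = n div q" and "j = n mod q"
    have j: "j < q" by (simp add: j_def mod)
    have "n = q * l + j" by (simp add: l_def j_def)
    also have "\<dots> \<le> q * (l + L)" using j by (simp add: L_def algebra_simps)
    finally have "real n \<le> real q * real (l + L)" by (metis of_nat_le_iff of_nat_mult)
    then have "real n / real q \<le> real (l + L)" using q_ge by (simp add: field_simps)
    then have "real (l + L) powr (- 2 * \<kappa>) \<le> (real n / real q) powr (- 2 * \<kappa>)"
      using n q_ge \<kappa> by (intro powr_mono2') auto
    also have "\<dots> = real q powr (2 * \<kappa>) * real n powr (- 2 * \<kappa>)"
      using n q_ge by (simp add: powr_divide powr_minus field_simps)
    finally have P2: "(P l)\<^sup>2 \<le> real q powr (2 * \<kappa>) * real n powr (- 2 * \<kappa>)"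
      by (simp add: P_def power2_eq_square powr_add[symmetric])
    have "\<bar>cos (real j * \<theta>) + c l * corrector j\<bar> \<le> 2"
      using small[OF j, of l] abs_cos_le_one[of "real j * \<theta>"] by linarith
    then have "\<bar>cos (real j * \<theta>) + c l * corrector j\<bar>\<^sup>2 \<le> 2\<^sup>2" by (rule power_mono) simp
    then have "(P l)\<^sup>2 * (cos (real j * \<theta>) + c l * corrector j)\<^sup>2 \<le> real q powr (2 * \<kappa>) * real n powr (- 2 * \<kappa>) * 4"
      using P2 by (intro mult_mono) auto
    then show "norm ((w n)\<^sup>2) \<le> 4 * real q powr (2 * \<kappa>) * real n powr (- 2 * \<kappa>)"
      by (simp add: w_def l_def[symmetric] j_def[symmetric] power_mult_distrib mult_ac flip: power_mult)
  qed
  moreover have "eventually (\<lambda>n. \<bar>real n * (2 * cos \<theta> - (w (n + 1) + w (n - 1)) / w n)\<bar> \<le> C) sequentially"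
  proof -
    \<comment> \<open>Bounds the wanted quantity at site \<open>j\<close> of block \<open>l\<close>,
      through \<open>n \<le> Suc l * q\<close>. It tends to \<open>a < C\<close> for each of the
      finitely many \<open>j\<close>.\<close>
    define h where "h j l = real (Suc l) * real q * \<bar>c l\<bar>
      * \<bar>cos (real j * \<theta>) / (cos (real j * \<theta>) + c l * corrector j)\<bar>" for j l
    have c0: "c \<longlonglongrightarrow> 0"
      unfolding c_def using \<gamma>0 by (rule LIMSEQ_ignore_initial_segment)
    have "(\<lambda>l. real (Suc l) / real (l + L) * (real (l + L) * \<gamma> (l + L))) \<longlonglongrightarrow> 1 * - (\<kappa> / gain)"
    proof (rule tendsto_mult)
      show "(\<lambda>l. real (Suc l) / real (l + L)) \<longlonglongrightarrow> 1"
        unfolding of_nat_Suc of_nat_add by real_asymp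
      show "(\<lambda>l. real (l + L) * \<gamma> (l + L)) \<longlonglongrightarrow> - (\<kappa> / gain)"
        using LIMSEQ_ignore_initial_segment[OF \<gamma>_lim, of L] by simp
    qed
    moreover have "real (l + L) \<noteq> 0" for l by (simp add: L_def)
    ultimately have "(\<lambda>l. real (Suc l) * c l) \<longlonglongrightarrow> 1 * - (\<kappa> / gain)"
      by (simp add: c_def)
    then have lim: "(\<lambda>l. \<bar>real (Suc l) * c l\<bar>) \<longlonglongrightarrow> \<bar>1 * - (\<kappa> / gain)\<bar>"
      by (rule tendsto_rabs)
    have "\<forall>j\<in>{..<q}. eventually (\<lambda>l. h j l < C) sequentially"
    proof
      fix j
      have "(\<lambda>l. real q * \<bar>real (Suc l) * c l\<bar> * \<bar>cos (real j * \<theta>) / (cos (real j * \<theta>) + c l * corrector j)\<bar>)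
        \<longlonglongrightarrow> real q * \<bar>1 * - (\<kappa> / gain)\<bar> * \<bar>cos (real j * \<theta>) / (cos (real j * \<theta>) + 0 * corrector j)\<bar>"
        by (intro tendsto_intros lim c0) (simp add: cos_theta_multiple_nonzero)
      moreover have "real q * \<bar>1 * - (\<kappa> / gain)\<bar> * \<bar>cos (real j * \<theta>) / (cos (real j * \<theta>) + 0 * corrector j)\<bar> = a"
        using a0 gain_pos q_ge cos_theta_multiple_nonzero[of j] by (simp add: \<kappa>_def)
      moreover have "h j = (\<lambda>l. real q * \<bar>real (Suc l) * c l\<bar> * \<bar>cos (real j * \<theta>) / (cos (real j * \<theta>) + c l * corrector j)\<bar>)"
        by (simp add: h_def fun_eq_iff abs_mult mult_ac)
      ultimately have "h j \<longlonglongrightarrow> a" by (simp only:)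
      then show "eventually (\<lambda>l. h j l < C) sequentially" using a(2) by (rule order_tendstoD)
    qed
    then have "eventually (\<lambda>l. \<forall>j\<in>{..<q}. h j l < C) sequentially"
      by (intro eventually_ball_finite) auto
    moreover have "filterlim (\<lambda>n. n div q) at_top sequentially"
      using q_ge by (intro filterlim_at_top_div_const_nat) auto
    ultimately have "eventually (\<lambda>n. \<forall>j\<in>{..<q}. h j (n div q) < C) sequentially"
      by (rule eventually_compose_filterlim)
    then show ?thesis
      using eventually_ge_at_top[of 1]
    proof eventually_elim
      case (elim n)
      define l j where "l = n div q" and "j = n mod q"
      have j: "j < q" by (simp add: j_def mod)
      define A where "A = (-1) ^ (p * l) * P l"
      have A: "A \<noteq> 0" using P_pos[of l] by (simp add: A_def)
      have wn: "w n = A * (cos (real j * \<theta>) + c l * corrector j)"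
        by (simp add: w_def A_def l_def j_def)
      have "w (n + 1) + w (n - 1) = 2 * cos \<theta> * w n - A * (c l * phase_sign j * cos (real j * \<theta>))"
        using block_solution_rec[of P c w, OF P_Suc w_def elim(2)] by (simp only: A_def l_def j_def)
      then have "2 * cos \<theta> - (w (n + 1) + w (n - 1)) / w n
          = c l * phase_sign j * (cos (real j * \<theta>) / (cos (real j * \<theta>) + c l * corrector j))"
      proof -
        have quot: "2 * t - X / (A * D) = s * (b / D)" if "X = 2 * t * (A * D) - A * (s * b)" "D \<noteq> 0" for t X s b D
          using A that(2) unfolding that(1) by (simp add: diff_divide_distrib)
        show ?thesis
          unfolding wn by (rule quot) (use \<open>w (n + 1) + w (n - 1) = _\<close> \<phi>_nz[OF j, of l] wn in auto)
      qed
      then have "\<bar>real n * (2 * cos \<theta> - (w (n + 1) + w (n - 1)) / w n)\<bar>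
          = real n * \<bar>phase_sign j\<bar> * (\<bar>c l\<bar> * \<bar>cos (real j * \<theta>) / (cos (real j * \<theta>) + c l * corrector j)\<bar>)"
        by (simp add: abs_mult)
      also have "\<dots> \<le> real n * 1 * (\<bar>c l\<bar> * \<bar>cos (real j * \<theta>) / (cos (real j * \<theta>) + c l * corrector j)\<bar>)"
        by (intro mult_right_mono mult_left_mono) (auto simp: phase_sign_def abs_sgn_eq)
      also have "\<dots> \<le> real (Suc l * q) * (\<bar>c l\<bar> * \<bar>cos (real j * \<theta>) / (cos (real j * \<theta>) + c l * corrector j)\<bar>)"
      proof -
        have "n = l * q + j" by (simp add: l_def j_def)
        then have "n \<le> Suc l * q" using j by simp
        then have "real n * 1 \<le> real (Suc l * q)" by (simp only: mult_1_right of_nat_le_iff)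
        then show ?thesis by (rule mult_right_mono) simp
      qed
      also have "\<dots> = h j l" by (simp only: h_def of_nat_mult mult_ac)
      also have "\<dots> \<le> C" using elim(1) j by (auto simp: l_def less_imp_le)
      finally show ?case .
    qed
  qed
  ultimately show ?thesis by (rule that)
qed

section \<open>Eigenvalues and boundary conditions\<close>

lemma not_eigenvalue:
  assumes "pot_size V < ereal (sin \<theta> / B q)"
  shows "\<not> is_eigenvalue V \<phi> (2 * cos \<theta>)"
proof
  have C: "sin \<theta> / B q > 0" using sin_theta_pos B_pos by simp
  obtain a' where a': "pot_size V < ereal a'" "ereal a' < ereal (sin \<theta> / B q)"
    using ereal_dense2[OF assms] by blast
  \<comment> \<open>The maximum supplies \<open>0 \<le> a\<close> and stays below the positive
    threshold.\<close>
  define a where "a = max a' 0"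
  have "eventually (\<lambda>n. ereal \<bar>real n * V n\<bar> < ereal a') sequentially"
    using a'(1) unfolding pot_size_def by (rule Limsup_lessD)
  then have small: "eventually (\<lambda>n. \<bar>real n * V n\<bar> \<le> a) sequentially"
    by eventually_elim (simp add: a_def)
  assume "is_eigenvalue V \<phi> (2 * cos \<theta>)"
  then obtain u n0 where u: "u n0 \<noteq> 0" "\<forall>n\<ge>1. schroedinger V u n = 2 * cos \<theta> * u n"
    "summable (\<lambda>n. \<bar>u n\<bar>\<^sup>2)"
    unfolding is_eigenvalue_def by blast
  have "\<not> summable (\<lambda>n. (u n)\<^sup>2)"
  proof (rule not_square_summable[OF small])
    show "u (n + 1) + u (n - 1) + V n * u n = 2 * cos \<theta> * u n" if "1 \<le> n" for n
      using u(2) that by (simp add: schroedinger_def)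
  qed (use a'(2) C u(1) in \<open>auto simp: a_def\<close>)
  with u(3) show False by simp
qed

text \<open>The values \<open>u 0\<close> and \<open>u 1\<close> encode the boundary condition, the
  later ones are a multiple of \<open>w\<close>, and \<open>V\<close> is read off from
  \<open>u\<close>. Changing finitely many values of \<open>V\<close> leaves its limsup
  alone.\<close>

lemma eigenvalue_exists:
  assumes "sin \<theta> / B q < C"
  shows "\<exists>V. potential V \<and> pot_size V \<le> ereal C \<and> is_eigenvalue V \<phi> (2 * cos \<theta>)"
proof -
  obtain w :: "nat \<Rightarrow> real" where w: "\<And>n. w n \<noteq> 0" "summable (\<lambda>n. (w n)\<^sup>2)"
    "eventually (\<lambda>n. \<bar>real n * (2 * cos \<theta> - (w (n + 1) + w (n - 1)) / w n)\<bar> \<le> C) sequentially"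
    using decaying_block_solution[OF assms] by blast
  \<comment> \<open>If \<open>sin \<phi> = 0\<close>, then \<open>u 1 = 0\<close> and
    \<open>V 1\<close> has no effect; the equation at 1 then demands \<open>u 2 = - u 0\<close>,
    which fixes the scale.\<close>
  define K where "K = (if sin \<phi> = 0 then - cos \<phi> / w 2 else 1)"
  have "cos \<phi> \<noteq> 0" if "sin \<phi> = 0" using that sin_cos_squared_add[of \<phi>] by auto
  then have K: "K \<noteq> 0" by (simp add: K_def w(1))
  define u where "u n = (if n = 0 then cos \<phi> else if n = 1 then sin \<phi> else K * w n)" for n
  define V where "V n = (if u n = 0 then 0 else 2 * cos \<theta> - (u (n + 1) + u (n - 1)) / u n)" for n
  have rec: "schroedinger V u n = 2 * cos \<theta> * u n" if "n \<ge> 1" for n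
  proof (cases "u n = 0")
    case True
    then have "n = 1" using that K w(1) by (auto simp: u_def split: if_splits)
    then show ?thesis using True w(1)[of 2] by (simp add: schroedinger_def u_def K_def numeral_2_eq_2)
  next
    case False
    then show ?thesis by (simp add: schroedinger_def V_def field_simps)
  qed
  have tail: "eventually (\<lambda>n. \<bar>real n * V n\<bar> \<le> C) sequentially"
    \<comment> \<open>From 3 on, \<open>n - 1\<close>, \<open>n\<close> and \<open>n + 1\<close> all
      lie where \<open>u\<close> is \<open>K * w\<close>.\<close>
    using w(3) eventually_ge_at_top[of 3]
  proof eventually_elim
    case (elim n)
    have "u (n + 1) = K * w (n + 1)" "u (n - 1) = K * w (n - 1)" "u n = K * w n"
      using elim(2) by (auto simp: u_def)
    then have "V n = 2 * cos \<theta> - (w (n + 1) + w (n - 1)) / w n"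
      using K w(1)[of n] by (simp add: V_def flip: distrib_left)
    then show ?case using elim(1) by simp
  qed
  have "summable u2" if "u2 = (\<lambda>n. \<bar>u n\<bar>\<^sup>2)" for u2
  proof (rule summable_comparison_test'[where N = 2 and g = "\<lambda>n. K\<^sup>2 * (w n)\<^sup>2"])
    show "summable (\<lambda>n. K\<^sup>2 * (w n)\<^sup>2)" by (intro summable_mult w(2))
  qed (simp add: that u_def power_mult_distrib)
  moreover have "u 2 \<noteq> 0" using K w(1) by (simp add: u_def)
  moreover have "boundary_condition \<phi> u" by (simp add: boundary_condition_def u_def)
  ultimately have "is_eigenvalue V \<phi> (2 * cos \<theta>)"
    unfolding is_eigenvalue_def using rec by blast
  moreover have "pot_size V \<le> ereal C"
    unfolding pot_size_def using tail by (intro Limsup_bounded) (auto elim: eventually_mono)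
  moreover have "potential V"
    unfolding potential_def
  \<comment> \<open>The factor 2 comes from \<open>1 + n \<le> 2 * n\<close> for positive
    \<open>n\<close>.\<close>
  proof (rule bigoI[where c = "2 * C"])
    show "eventually (\<lambda>n. norm (V n) \<le> 2 * C * norm (1 / (1 + real n))) sequentially"
      using tail eventually_ge_at_top[of 1]
    proof eventually_elim
      case (elim n)
      have "(1 + real n) * \<bar>V n\<bar> \<le> 2 * real n * \<bar>V n\<bar>" using elim(2) by (intro mult_right_mono) auto
      also have "\<dots> \<le> 2 * C" using elim(1) by (simp add: abs_mult)
      finally show ?case by (simp add: field_simps)
    qed
  qed
  ultimately show ?thesis by blast
qed

end

section \<open>The critical value\<close>

lemma critical_value_eqI:
  assumes "is_critical_value E C"
  shows "critical_value E = C"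
  unfolding critical_value_def
proof (rule the_equality)
  show "is_critical_value E C" by (rule assms)
next
  have no_less: False if crit: "is_critical_value E C1" "is_critical_value E C2" "C1 < C2" for C1 C2
  proof -
    have "C2 - C1 > 0" using crit(3) by simp
    then obtain V where "potential V" "pot_size V < ereal (C1 + (C2 - C1))" "is_eigenvalue V 0 E"
      using crit(1) unfolding is_critical_value_def by blast
    then show False using crit(2) unfolding is_critical_value_def by simp
  qed
  show "C' = C" if "is_critical_value E C'" for C'
    using no_less[OF assms that] no_less[OF that assms] by (metis linorder_neqE_linordered_idom)
qed

theorem theorem1p1:
  fixes p q :: nat and k E :: real
  assumes "k = real p / real q" and "0 < k" and "k < 1"
    and "0 < p" and "coprime p q" and "3 \<le> q" and "odd q"
    and "E = 2 * cos (pi * k)"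
  shows "(\<forall>V \<phi>. potential V \<and> pot_size V < ereal (sin (pi * k) / B q)
            \<longrightarrow> \<not> is_eigenvalue V \<phi> E)
       \<and> (\<forall>\<epsilon>>0. \<forall>\<phi>. \<exists>V. potential V \<and> pot_size V < ereal (sin (pi * k) / B q + \<epsilon>)
            \<and> is_eigenvalue V \<phi> E)
       \<and> critical_value E = sin (pi * k) / B q"
proof -
  interpret rational_energy p q "pi * k"
  proof
    show "p < q" using assms(1,3,6) by (simp add: divide_less_eq)
  qed (use assms in auto)
  have "is_critical_value E (sin (pi * k) / B q)"
    unfolding is_critical_value_def
  proof (intro conjI allI impI)
    show "\<not> is_eigenvalue V \<phi> E" if "potential V \<and> pot_size V < ereal (sin (pi * k) / B q)" for V \<phi>
      using not_eigenvalue that assms(8) by simp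
    fix \<epsilon> :: real and \<phi> assume "\<epsilon> > 0"
    \<comment> \<open>The construction gives a non-strict bound; spending half of \<epsilon> makes
      it strict.\<close>
    then obtain V where V: "potential V" "pot_size V \<le> ereal (sin (pi * k) / B q + \<epsilon> / 2)"
        "is_eigenvalue V \<phi> (2 * cos (pi * k))"
      using eigenvalue_exists[of "sin (pi * k) / B q + \<epsilon> / 2" \<phi>] by auto
    have "ereal (sin (pi * k) / B q + \<epsilon> / 2) < ereal (sin (pi * k) / B q + \<epsilon>)"
      using \<open>\<epsilon> > 0\<close> by simp
    with V(2) have "pot_size V < ereal (sin (pi * k) / B q + \<epsilon>)" by (rule le_less_trans)
    with V(1,3) assms(8)
    show "\<exists>V. potential V \<and> pot_size V < ereal (sin (pi * k) / B q + \<epsilon>) \<and> is_eigenvalue V \<phi> E"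
      by auto
  qed
  then show ?thesis
    using critical_value_eqI unfolding is_critical_value_def by blast
qed

end
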